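(* Let $k\ge 2$. A bipartite graph $G$ is a $k$-critical ACB graph if and only if $G$ is isomorphic to $B_k$.
   Context: For a bipartite graph $B=(X,Y,E)$ with color classes $X,Y$: the mirror $mir(B)$ has the same color classes and $xy$ ($x\in X$, $y\in Y$) is an edge iff it is not an edge of $B$; $B$ is chordal bipartite if it has no induced chordless cycle $C_{2m}$, $m\ge3$; $B$ is ACB if both $B$ and $mir(B)$ are chordal bipartite. $\nabla_B(X)$ is the maximum number of vertices of $X$ whose neighborhoods are pairwise incomparable under set inclusion (equal neighborhoods count as comparable), $\nabla_B(Y)$ analogously, and the bipartite Dilworth number is $bip\text{-}dilw(B)=\max(\nabla_B(X),\nabla_B(Y))$. An ACB graph $G$ is $k$-critical if $bip\text{-}dilw(G)=k$ and $bip\text{-}dilw(G-v)\le k-1$ for every vertex $v$ (where $G-v$ is the bipartite graph obtained by deleting $v$). $B_k$ is the bipartite graph with color classes $\{x_1,\dots,x_k\}$ and $\{y_1,\dots,y_{2k-2}\}$ in which $N(x_i)=\{y_i,\dots,y_{i+k-2}\}$ for $i=1,\dots,k$. *)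

theory Defs
  imports Main
begin

text \<open>
  A bipartite graph comes with its two color classes. An undirected edge between
  \<open>x \<in> colX G\<close> and \<open>y \<in> colY G\<close> is stored once, as the pair \<open>(x, y)\<close>.
\<close>

record 'a bigraph =
  colX :: "'a set"
  colY :: "'a set"
  edges :: "('a \<times> 'a) set"

definition bipartite_graph :: "'a bigraph \<Rightarrow> bool" where
  "bipartite_graph G \<longleftrightarrow>
     finite (colX G) \<and> finite (colY G) \<and> colX G \<inter> colY G = {} \<and>
     edges G \<subseteq> colX G \<times> colY G"

definition verts :: "'a bigraph \<Rightarrow> 'a set" where
  "verts G = colX G \<union> colY G"

definition adj :: "'a bigraph \<Rightarrow> 'a \<Rightarrow> 'a \<Rightarrow> bool" where
  "adj G u v \<longleftrightarrow> (u, v) \<in> edges G \<or> (v, u) \<in> edges G"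

definition nbhd :: "'a bigraph \<Rightarrow> 'a \<Rightarrow> 'a set" where
  "nbhd G v = {u \<in> verts G. adj G v u}"

definition mir :: "'a bigraph \<Rightarrow> 'a bigraph" where
  "mir G = \<lparr> colX = colX G, colY = colY G, edges = colX G \<times> colY G - edges G \<rparr>"

definition del_vertex :: "'a bigraph \<Rightarrow> 'a \<Rightarrow> 'a bigraph" where
  "del_vertex G v =
     \<lparr> colX = colX G - {v}, colY = colY G - {v},
       edges = {(x, y) \<in> edges G. x \<noteq> v \<and> y \<noteq> v} \<rparr>"

text \<open>
  The vertices \<open>c 0, \<dots>, c (n - 1)\<close>, in this cyclic order, induce a chordless cycle
  (for \<open>n \<ge> 3\<close>): the only adjacencies are those between cyclically consecutive vertices.
\<close>

definition induced_cycle :: "'a bigraph \<Rightarrow> nat \<Rightarrow> (nat \<Rightarrow> 'a) \<Rightarrow> bool" where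
  "induced_cycle G n c \<longleftrightarrow>
     c ` {..<n} \<subseteq> verts G \<and> inj_on c {..<n} \<and>
     (\<forall>i<n. \<forall>j<n. adj G (c i) (c j) \<longleftrightarrow> j = Suc i mod n \<or> i = Suc j mod n)"

definition chordal_bipartite :: "'a bigraph \<Rightarrow> bool" where
  "chordal_bipartite G \<longleftrightarrow>
     bipartite_graph G \<and> \<not> (\<exists>m c. m \<ge> 3 \<and> induced_cycle G (2 * m) c)"

definition ACB :: "'a bigraph \<Rightarrow> bool" where
  "ACB G \<longleftrightarrow> chordal_bipartite G \<and> chordal_bipartite (mir G)"

definition incomparable_nbhds :: "'a bigraph \<Rightarrow> 'a set \<Rightarrow> bool" where
  "incomparable_nbhds G A \<longleftrightarrow>
     (\<forall>u\<in>A. \<forall>v\<in>A. u \<noteq> v \<longrightarrow> \<not> nbhd G u \<subseteq> nbhd G v \<and> \<not> nbhd G v \<subseteq> nbhd G u)"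

definition nabla :: "'a bigraph \<Rightarrow> 'a set \<Rightarrow> nat" where
  "nabla G S = Max {card A | A. A \<subseteq> S \<and> incomparable_nbhds G A}"

definition bip_dilw :: "'a bigraph \<Rightarrow> nat" where
  "bip_dilw G = max (nabla G (colX G)) (nabla G (colY G))"

definition critical_ACB :: "nat \<Rightarrow> 'a bigraph \<Rightarrow> bool" where
  "critical_ACB k G \<longleftrightarrow>
     ACB G \<and> bip_dilw G = k \<and> (\<forall>v\<in>verts G. bip_dilw (del_vertex G v) \<le> k - 1)"

text \<open>
  The vertex \<open>x\<^sub>i\<close> is \<open>Inl i\<close> and \<open>y\<^sub>j\<close> is \<open>Inr j\<close>. The definition is meant
  for \<open>k \<ge> 2\<close>, where the subtractions are not truncated.
\<close>

definition B :: "nat \<Rightarrow> (nat + nat) bigraph" where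
  "B k =
     \<lparr> colX = Inl ` {1..k}, colY = Inr ` {1..2 * k - 2},
       edges = {(Inl i, Inr j) | i j. i \<in> {1..k} \<and> j \<in> {i..i + k - 2}} \<rparr>"

text \<open>
  Isomorphism of the underlying graphs. A map that fixes the order of the color classes
  would be too strict: \<open>bip_dilw\<close> is symmetric in the two classes, so exchanging the
  classes of a critical graph gives a critical graph.
\<close>

definition isomorphic :: "'a bigraph \<Rightarrow> 'b bigraph \<Rightarrow> bool" where
  "isomorphic G H \<longleftrightarrow>
     (\<exists>f. bij_betw f (verts G) (verts H) \<and>
          (\<forall>u\<in>verts G. \<forall>v\<in>verts G. adj G u v \<longleftrightarrow> adj H (f u) (f v)))"

end

theory Submission
  imports Defs
begin

text \<open>
  Let \<open>A\<close> be an antichain in one color class of an ACB graph, and consider the traces on \<open>A\<close>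
  of the neighborhoods of the other class. As \<open>C\<^sub>6\<close> and \<open>3K\<^sub>2\<close> (the mirror of \<open>C\<^sub>6\<close>) are
  excluded, in every triple of \<open>A\<close> exactly one element is never split from the other two;
  as \<open>C\<^sub>8\<close> is excluded too, no two traces cross. A trace, or complement of a trace, of
  minimal size is then a singleton \<open>{p}\<close>, and the traces, complemented where they contain
  \<open>p\<close>, form a chain. So \<open>A\<close> has a linear order starting at \<open>p\<close> in which every trace is an
  initial or a final segment, and separation forces all of these to occur. The proper
  nonempty initial and final segments of a \<open>k\<close>-element chain are exactly the neighborhoods
  of the \<open>y\<^sub>j\<close> in \<open>B\<^sub>k\<close>. Conversely, initial and final segments form two chains, which
  leaves no room for a cycle with three vertices in \<open>Y\<close>.
\<close>

section \<open>Families of sets with few splits\<close>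

text \<open>\<open>F\<close> plays the neighborhoods of the opposite color class; its members need
  not be subsets of \<open>A\<close>. \<open>sep\<close> is the antichain condition. The three
  exclusions describe incidence patterns between points and members of \<open>F\<close>:
  \<open>no_triangle\<close> an induced 6-cycle, \<open>no_matching\<close> three disjoint edges,
  \<open>no_square\<close> an induced 8-cycle.\<close>

locale separating_family =
  fixes A :: "'a set" and F :: "'a set set"
  assumes fin: "finite A"
    and sep: "\<lbrakk>a \<in> A; b \<in> A; a \<noteq> b\<rbrakk> \<Longrightarrow> \<exists>S\<in>F. a \<in> S \<and> b \<notin> S"
    and no_triangle: "\<lbrakk>a \<in> A; b \<in> A; c \<in> A; S \<in> F; T \<in> F; U \<in> F;
      a \<notin> S; b \<in> S; c \<in> S; a \<in> T; b \<notin> T; c \<in> T; a \<in> U; b \<in> U; c \<notin> U\<rbrakk> \<Longrightarrow> False"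
    and no_matching: "\<lbrakk>a \<in> A; b \<in> A; c \<in> A; S \<in> F; T \<in> F; U \<in> F;
      a \<in> S; b \<notin> S; c \<notin> S; a \<notin> T; b \<in> T; c \<notin> T; a \<notin> U; b \<notin> U; c \<in> U\<rbrakk> \<Longrightarrow> False"
    and no_square: "\<lbrakk>a \<in> A; b \<in> A; c \<in> A; d \<in> A; S \<in> F; T \<in> F; U \<in> F; V \<in> F;
      a \<in> S; b \<in> S; c \<notin> S; d \<notin> S; a \<notin> T; b \<in> T; c \<in> T; d \<notin> T;
      a \<notin> U; b \<notin> U; c \<in> U; d \<in> U; a \<in> V; b \<notin> V; c \<notin> V; d \<in> V\<rbrakk> \<Longrightarrow> False"
begin

text \<open>Not sensitive to complementing \<open>S\<close>, so traces and their complements are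
  treated alike.\<close>

definition split :: "'a \<Rightarrow> 'a \<Rightarrow> 'a \<Rightarrow> bool" where
  "split a b c \<longleftrightarrow> (\<exists>S\<in>F. (a \<in> S) \<noteq> (b \<in> S) \<and> (a \<in> S) \<noteq> (c \<in> S))"

lemma splitI: "\<lbrakk>S \<in> F; (a \<in> S) \<noteq> (b \<in> S); (a \<in> S) \<noteq> (c \<in> S)\<rbrakk> \<Longrightarrow> split a b c"
  unfolding split_def by blast

text \<open>Of the three ways to split a triple, exactly one is missing; each of the other
  two is realised both by a singleton and by a pair.\<close>

lemma two_splits:
  assumes A: "a \<in> A" "b \<in> A" "c \<in> A" and ne: "a \<noteq> b" "a \<noteq> c" "b \<noteq> c"
    and sp: "split a b c" "split c a b"
  shows "\<not> split b a c" and "\<exists>S\<in>F. a \<in> S \<and> b \<notin> S \<and> c \<notin> S"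
proof -
  \<comment> \<open>On the triple, \<open>t x y z\<close> says that the trace {x} occurs and
    \<open>p x y z\<close> that the trace {y, z} occurs.\<close>
  define t where "t = (\<lambda>x y z. \<exists>S\<in>F. x \<in> S \<and> y \<notin> S \<and> z \<notin> S)"
  define p where "p = (\<lambda>x y z. \<exists>S\<in>F. x \<notin> S \<and> y \<in> S \<and> z \<in> S)"
  have sym: "t x y z = t x z y" "p x y z = p x z y" for x y z
    unfolding t_def p_def by blast+
  have split: "split x y z \<longleftrightarrow> t x y z \<or> p x y z" for x y z
    unfolding split_def t_def p_def by blast
  \<comment> \<open>A member of \<open>F\<close> that contains \<open>x\<close> but not
    \<open>y\<close> has trace {x} or {x, z}, depending on \<open>z\<close>.\<close>
  have s: "t x y z \<or> p y x z" if "x \<in> A" "y \<in> A" "x \<noteq> y" for x y z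
    using sep[OF that] unfolding t_def p_def by blast
  have "\<not> (t a b c \<and> t b a c \<and> t c a b)"
    unfolding t_def using no_matching[OF A] by blast
  moreover have "\<not> (p a b c \<and> p b a c \<and> p c a b)"
    unfolding p_def using no_triangle[OF A] by blast
  moreover have "t a b c \<or> p b a c" "t b a c \<or> p a b c"
    using s[of a b c] s[of b a c] A ne by auto
  moreover have "t a b c \<or> p c a b" "t c a b \<or> p a b c"
    using s[of a c b] s[of c a b] A ne sym by auto
  moreover have "t b a c \<or> p c a b" "t c a b \<or> p b a c"
    using s[of b c a] s[of c b a] A ne sym by auto
  \<comment> \<open>If {a} did not occur, then {a, c} and {a, b} both would, hence {b, c} would not,
    and \<open>a\<close> would not split at all. Dually {b, c} occurs. The same holds for
    \<open>c\<close>, so all singletons and all pairs would be present if \<open>b\<close>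
    contributed either kind for which the other two are already there.\<close>
  ultimately have "\<not> (t b a c \<or> p b a c) \<and> t a b c" using sp split by blast
  then show "\<not> split b a c" "\<exists>S\<in>F. a \<in> S \<and> b \<notin> S \<and> c \<notin> S"
    using split t_def by auto
qed

lemma split_commute: "split a b c = split a c b"
  unfolding split_def by blast

text \<open>In the triple \<open>u\<close>, \<open>v\<close>, \<open>w\<close>, the set
  \<open>T\<close> splits off \<open>v\<close> and \<open>S\<close> splits off \<open>w\<close>, so
  both also occur as singleton traces, via \<open>R\<close> and \<open>Q\<close>. In the triples
  \<open>u\<close>, \<open>v\<close>, \<open>z\<close> and \<open>u\<close>, \<open>w\<close>,
  \<open>z\<close> it is \<open>u\<close> and \<open>z\<close> that split, so \<open>v\<close> and
  \<open>w\<close> do not. This forces \<open>z\<close> into \<open>R\<close> and \<open>Q\<close>,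
  and \<open>S\<close>, \<open>R\<close>, \<open>Q\<close>, \<open>T\<close> close an 8-cycle
  through \<open>u\<close>, \<open>v\<close>, \<open>z\<close>, \<open>w\<close>.\<close>

lemma no_crossing:
  assumes "S \<in> F" "T \<in> F" and A: "u \<in> A" "v \<in> A" "w \<in> A" "z \<in> A"
    and u: "u \<in> S" "u \<in> T" and v: "v \<in> S" "v \<notin> T"
    and w: "w \<notin> S" "w \<in> T" and z: "z \<notin> S" "z \<notin> T"
  shows False
proof -
  have ne: "u \<noteq> v" "u \<noteq> w" "u \<noteq> z" "v \<noteq> w" "v \<noteq> z" "w \<noteq> z"
    using u v w z by auto
  have "split v u w" "split w v u" "split u v z" "split z u v"
    "split u w z" "split z u w"
    using assms by (auto intro: splitI[OF \<open>S \<in> F\<close>] splitI[OF \<open>T \<in> F\<close>])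
  note sp = this
  obtain R where R: "R \<in> F" "v \<in> R" "u \<notin> R" "w \<notin> R"
    using two_splits(2)[of v u w] A ne sp by blast
  obtain Q where Q: "Q \<in> F" "w \<in> Q" "u \<notin> Q" "v \<notin> Q"
    using two_splits(2)[of w u v] A ne sp split_commute by blast
  have nv: "\<not> split v u z" using two_splits(1)[of u v z] A ne sp by blast
  have nw: "\<not> split w u z" using two_splits(1)[of u w z] A ne sp by blast
  have "z \<in> R" using nv R splitI by blast
  moreover have "z \<in> Q" using nw Q splitI by blast
  ultimately show False
    using no_square[of u v z w S R Q T] A assms(1,2) R Q u v w z by blast
qed

text \<open>Supplies the first element of the linear order. The conclusion uses an inequality of
  truth values because the singleton may be a trace or the complement of one.\<close>

lemma ex_isolated:
  assumes "card A \<ge> 2"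
  obtains p S where "p \<in> A" "S \<in> F" "\<And>a. a \<in> A \<Longrightarrow> a \<noteq> p \<Longrightarrow> (a \<in> S) \<noteq> (p \<in> S)"
proof -
  define M where "M = {W. W \<noteq> {} \<and> (\<exists>S\<in>F. W = S \<inter> A \<or> W = A - S)}"
  obtain a b where "a \<in> A" "b \<in> A" "a \<noteq> b"
    using assms by (metis card_le_Suc0_iff_eq fin not_less_eq_eq numeral_2_eq_2)
  then obtain S where "S \<in> F" "a \<in> S \<inter> A" using sep by blast
  then have "S \<inter> A \<in> M" unfolding M_def by blast
  then obtain W where W: "W \<in> M" and min: "\<And>V. V \<in> M \<Longrightarrow> card W \<le> card V"
    using ex_min_if_finite arg_min_nat_lemma[of "\<lambda>V. V \<in> M" "S \<inter> A" card] by metis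
  obtain S where S: "S \<in> F" "W = S \<inter> A \<or> W = A - S" using W M_def by blast
  obtain p where p: "p \<in> W" using W M_def by blast
  have WA: "W \<subseteq> A" using S by blast
  have nsub: "\<not> V \<subset> W" if "V \<in> M" for V
    using min[OF that] psubset_card_mono[of W V] WA fin finite_subset
    by (metis not_less)
  have "v = p" if v: "v \<in> W" for v
  proof (rule ccontr)
    assume "v \<noteq> p"
    then obtain T where T: "T \<in> F" "p \<in> T" "v \<notin> T" using sep[of p v] WA v p by blast
    have "T \<inter> A \<in> M" "A - T \<in> M" using T p v WA unfolding M_def by blast+
    \<comment> \<open>\<open>T\<close> misses \<open>v\<close> and \<open>A - T\<close> misses
      \<open>p\<close>, so inclusion in \<open>W\<close> would be proper and contradict minimality.
      Hence all four cells cut out by \<open>T\<close> and \<open>W\<close> are occupied.\<close>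
    then have "\<not> T \<inter> A \<subset> W" "\<not> A - T \<subset> W" using nsub by blast+
    then obtain w z where "w \<in> T" "w \<in> A" "w \<notin> W" "z \<in> A" "z \<notin> T" "z \<notin> W"
      using T p v by blast
    \<comment> \<open>If \<open>W\<close> is \<open>A - S\<close>, the pair inside \<open>W\<close>
      and the pair outside it exchange roles; this is the second instance.\<close>
    then show False
      using S no_crossing[of S T p v w z] no_crossing[of S T w z p v] T p v WA by blast
  qed
  then have "W = {p}" using p by blast
  then show thesis using that[of p S] S p WA by blast
qed

lemma ex_linear_arrangement:
  assumes "card A \<ge> 2"
  obtains pos :: "'a \<Rightarrow> nat" where "bij_betw pos A {1..card A}"
    "\<And>j. \<lbrakk>1 \<le> j; j < card A\<rbrakk> \<Longrightarrow> \<exists>S\<in>F. \<forall>a\<in>A. a \<in> S \<longleftrightarrow> pos a \<le> j"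
    "\<And>j. \<lbrakk>1 \<le> j; j < card A\<rbrakk> \<Longrightarrow> \<exists>S\<in>F. \<forall>a\<in>A. a \<in> S \<longleftrightarrow> j < pos a"
proof -
  obtain p S0 where p: "p \<in> A" "S0 \<in> F" "\<And>a. a \<in> A \<Longrightarrow> a \<noteq> p \<Longrightarrow> (a \<in> S0) \<noteq> (p \<in> S0)"
    using ex_isolated[OF assms] by blast
  \<comment> \<open>The trace, complemented if it contains \<open>p\<close>; so
    \<open>up S p\<close> never holds, and \<open>p\<close> is never above another element in
    \<open>lt\<close>.\<close>
  define up where "up = (\<lambda>S a. (a \<in> S) \<noteq> (p \<in> S))"
  define lt where "lt = (\<lambda>u v. \<exists>S\<in>F. up S v \<and> \<not> up S u)"
  \<comment> \<open>\<open>S0\<close> splits \<open>p\<close> from \<open>u\<close> and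
    \<open>v\<close>, so at most one of \<open>u\<close> and \<open>v\<close> can split in this
    triple; a cycle in \<open>lt\<close> would split both.\<close>
  have asym: False if A: "u \<in> A" "v \<in> A" and lt: "lt u v" "lt v u" for u v
  proof -
    obtain S T where S: "S \<in> F" "up S v" "\<not> up S u" and T: "T \<in> F" "up T u" "\<not> up T v"
      using lt lt_def by blast
    have ne: "u \<noteq> p" "v \<noteq> p" "u \<noteq> v" using S T up_def by blast+
    have "split v p u" "split u v p" using S T unfolding up_def by (blast intro: splitI)+
    moreover have "split p v u" using p A ne by (auto intro: splitI[of S0])
    ultimately show False using two_splits(1)[of v p u] A p ne by blast
  qed
  have total: "lt u v \<or> lt v u" if "u \<in> A" "v \<in> A" "u \<noteq> v" for u v
    using sep[OF that] unfolding lt_def up_def by blast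
  have trans: "lt u w" if "u \<in> A" "v \<in> A" "w \<in> A" "lt u v" "lt v w" for u v w
    using that asym[of v w] unfolding lt_def by blast
  \<comment> \<open>Counts the elements not after \<open>u\<close>, including \<open>u\<close>
    itself, so positions start at 1.\<close>
  define pos where "pos = (\<lambda>u. card {w \<in> A. \<not> lt u w})"
  have mono: "pos u < pos v" if "u \<in> A" "v \<in> A" "lt u v" for u v
    unfolding pos_def
  proof (rule psubset_card_mono)
    have "\<not> lt v v" using asym that by blast
    then show "{w \<in> A. \<not> lt u w} \<subset> {w \<in> A. \<not> lt v w}"
      using trans[of u v] that by blast
  qed (use fin in simp)
  have inj: "inj_on pos A"
    unfolding inj_on_def using total mono by (metis less_irrefl)
  have range: "pos ` A \<subseteq> {1..card A}"
  proof (rule image_subsetI)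
    fix u assume u: "u \<in> A"
    then have "u \<in> {w \<in> A. \<not> lt u w}" using asym by blast
    then have "pos u > 0" unfolding pos_def using fin by (auto simp: card_gt_0_iff)
    moreover have "pos u \<le> card A" unfolding pos_def using fin by (auto intro: card_mono)
    ultimately show "pos u \<in> {1..card A}" by simp
  qed
  have bij: "bij_betw pos A {1..card A}"
    unfolding bij_betw_def using inj range card_image[OF inj]
    by (metis card_atLeastAtMost card_subset_eq diff_Suc_1 finite_atLeastAtMost One_nat_def)
  \<comment> \<open>\<open>up S\<close> is closed upwards in the order, so \<open>S\<close> itself
    is a final segment if \<open>p\<close> is outside it and an initial segment otherwise.\<close>
  have closed: "(\<forall>u\<in>A. \<forall>v\<in>A. pos u \<le> pos v \<longrightarrow> u \<in> S \<longrightarrow> v \<in> S) \<or>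
      (\<forall>u\<in>A. \<forall>v\<in>A. pos u \<le> pos v \<longrightarrow> v \<in> S \<longrightarrow> u \<in> S)" if "S \<in> F" for S
  proof -
    have "up S v" if "u \<in> A" "v \<in> A" "pos u \<le> pos v" "up S u" for u v
      using that mono[of v u] \<open>S \<in> F\<close> unfolding lt_def by fastforce
    then show ?thesis unfolding up_def by (cases "p \<in> S") blast+
  qed
  have neighbours: "\<exists>u\<in>A. \<exists>v\<in>A. pos u = j \<and> pos v = Suc j" if "1 \<le> j" "j < card A" for j
  proof -
    have "j \<in> pos ` A" "Suc j \<in> pos ` A"
      using bij that unfolding bij_betw_def by auto
    then show ?thesis by (metis imageE)
  qed
  show thesis
  proof (rule that[OF bij])
    fix j assume "1 \<le> j" "j < card A"
    then obtain u v where uv: "u \<in> A" "v \<in> A" "pos u = j" "pos v = Suc j"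
      using neighbours by blast
    then have ne: "u \<noteq> v" by auto
    \<comment> \<open>A segment that contains \<open>u\<close> but not its immediate successor
      \<open>v\<close> must be the initial segment ending at \<open>u\<close>. Separating in the
      other direction gives the final segment starting at \<open>v\<close>.\<close>
    obtain S where S: "S \<in> F" "u \<in> S" "v \<notin> S" using sep uv ne by blast
    have "a \<in> S \<longleftrightarrow> pos a \<le> j" if "a \<in> A" for a
      using closed[OF S(1)] S uv that by (metis le_SucI le_refl not_less_eq_eq)
    then show "\<exists>S\<in>F. \<forall>a\<in>A. a \<in> S \<longleftrightarrow> pos a \<le> j" using S by blast
    obtain T where T: "T \<in> F" "v \<in> T" "u \<notin> T" using sep uv ne by metis
    have "a \<in> T \<longleftrightarrow> j < pos a" if "a \<in> A" for a
      using closed[OF T(1)] T uv that by (metis Suc_leI le_SucI le_refl not_less)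
    then show "\<exists>S\<in>F. \<forall>a\<in>A. a \<in> S \<longleftrightarrow> j < pos a" using T by blast
  qed
qed

end

section \<open>Bipartite graphs\<close>

lemma adj_commute: "adj G u v = adj G v u"
  unfolding adj_def by blast

lemma bipartite_adj:
  assumes "bipartite_graph G"
  shows "\<lbrakk>x \<in> colX G; y \<in> colY G\<rbrakk> \<Longrightarrow> adj G x y \<longleftrightarrow> (x, y) \<in> edges G"
    and "\<lbrakk>x \<in> colX G; y \<in> colY G\<rbrakk> \<Longrightarrow> adj G y x \<longleftrightarrow> (x, y) \<in> edges G"
    and "\<lbrakk>x \<in> colX G; x' \<in> colX G\<rbrakk> \<Longrightarrow> \<not> adj G x x'"
    and "\<lbrakk>y \<in> colY G; y' \<in> colY G\<rbrakk> \<Longrightarrow> \<not> adj G y y'"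
  using assms unfolding bipartite_graph_def adj_def by blast+

lemma bipartite_nbhd:
  assumes "bipartite_graph G"
  shows "x \<in> colX G \<Longrightarrow> nbhd G x = {y \<in> colY G. (x, y) \<in> edges G}"
    and "y \<in> colY G \<Longrightarrow> nbhd G y = {x \<in> colX G. (x, y) \<in> edges G}"
  using assms unfolding bipartite_graph_def nbhd_def verts_def adj_def by blast+

lemma mir_simps [simp]:
  "colX (mir G) = colX G" "colY (mir G) = colY G"
  "edges (mir G) = colX G \<times> colY G - edges G"
  by (simp_all add: mir_def)

lemma bipartite_mir: "bipartite_graph G \<Longrightarrow> bipartite_graph (mir G)"
  unfolding bipartite_graph_def by auto

lemma del_vertex_simps [simp]:
  "colX (del_vertex G v) = colX G - {v}" "colY (del_vertex G v) = colY G - {v}"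
  "verts (del_vertex G v) = verts G - {v}"
  by (auto simp: del_vertex_def verts_def)

lemma adj_del_vertex: "adj (del_vertex G v) u w \<longleftrightarrow> adj G u w \<and> u \<noteq> v \<and> w \<noteq> v"
  by (auto simp: del_vertex_def adj_def)

lemma nbhd_del_vertex: "u \<noteq> v \<Longrightarrow> nbhd (del_vertex G v) u = nbhd G u - {v}"
  by (auto simp: nbhd_def adj_del_vertex)

section \<open>Exchange of the two color classes, for reduction to an antichain in
  \<open>colX\<close>\<close>

definition swap_classes :: "'a bigraph \<Rightarrow> 'a bigraph" where
  "swap_classes G = \<lparr>colX = colY G, colY = colX G, edges = (edges G)\<inverse>\<rparr>"

lemma swap_classes_simps [simp]:
  "colX (swap_classes G) = colY G" "colY (swap_classes G) = colX G"
  "edges (swap_classes G) = (edges G)\<inverse>" "verts (swap_classes G) = verts G"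
  by (auto simp: swap_classes_def verts_def)

lemma adj_swap_classes [simp]: "adj (swap_classes G) = adj G"
  by (auto simp: adj_def fun_eq_iff)

lemma nbhd_swap_classes [simp]: "nbhd (swap_classes G) = nbhd G"
  by (auto simp: nbhd_def fun_eq_iff)

lemma bipartite_swap_classes [simp]: "bipartite_graph (swap_classes G) = bipartite_graph G"
  unfolding bipartite_graph_def by auto

lemma mir_swap_classes: "mir (swap_classes G) = swap_classes (mir G)"
  by (auto simp: mir_def swap_classes_def)

lemma del_vertex_swap_classes: "del_vertex (swap_classes G) v = swap_classes (del_vertex G v)"
  by (auto simp: del_vertex_def swap_classes_def)

lemma ACB_swap_classes [simp]: "ACB (swap_classes G) = ACB G"
  unfolding ACB_def chordal_bipartite_def induced_cycle_def by (simp add: mir_swap_classes)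

lemma bip_dilw_swap_classes [simp]: "bip_dilw (swap_classes G) = bip_dilw G"
  unfolding bip_dilw_def nabla_def incomparable_nbhds_def by (simp add: max.commute)

lemma critical_ACB_swap_classes: "critical_ACB k (swap_classes G) = critical_ACB k G"
  unfolding critical_ACB_def by (simp add: del_vertex_swap_classes)

section \<open>Antichains of neighborhoods and the Dilworth number\<close>

lemma finite_nabla_set: "finite S \<Longrightarrow> finite {card A | A. A \<subseteq> S \<and> incomparable_nbhds G A}"
  by (rule finite_subset[of _ "card ` Pow S"]) auto

lemma nabla_ge: "\<lbrakk>finite S; A \<subseteq> S; incomparable_nbhds G A\<rbrakk> \<Longrightarrow> card A \<le> nabla G S"
  unfolding nabla_def by (rule Max_ge[OF finite_nabla_set]) auto

lemma nabla_attained: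
  assumes "finite S"
  obtains A where "A \<subseteq> S" "incomparable_nbhds G A" "card A = nabla G S"
proof -
  \<comment> \<open>The empty antichain makes the set under the maximum nonempty.\<close>
  have "incomparable_nbhds G {}" unfolding incomparable_nbhds_def by blast
  then have "nabla G S \<in> {card A | A. A \<subseteq> S \<and> incomparable_nbhds G A}"
    unfolding nabla_def using Max_in[OF finite_nabla_set[OF assms]] by blast
  then show thesis using that by auto
qed

lemma nabla_le:
  "\<lbrakk>finite S; \<And>A. \<lbrakk>A \<subseteq> S; incomparable_nbhds G A\<rbrakk> \<Longrightarrow> card A \<le> n\<rbrakk> \<Longrightarrow> nabla G S \<le> n"
  using nabla_attained by metis

lemma card_antichain_le_bip_dilw:
  assumes "finite (colX G)" "finite (colY G)" "A \<subseteq> colX G \<or> A \<subseteq> colY G"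
    "incomparable_nbhds G A"
  shows "card A \<le> bip_dilw G"
  using assms nabla_ge[of "colX G" A G] nabla_ge[of "colY G" A G]
  unfolding bip_dilw_def by fastforce

section \<open>Induced cycles\<close>

text \<open>The cycle runs \<open>x 0\<close>, \<open>y 0\<close>, \<open>x 1\<close>,
  \<open>y 1\<close>, and so on: \<open>x a\<close> receives index 2a and \<open>y b\<close> index
  2b + 1, which turns adjacency modulo 2m into a condition modulo \<open>m\<close>.\<close>

lemma induced_cycle_alternating:
  assumes G: "bipartite_graph G"
    and X: "\<And>i. i < m \<Longrightarrow> x i \<in> colX G" and Y: "\<And>i. i < m \<Longrightarrow> y i \<in> colY G"
    and inj: "inj_on x {..<m}" "inj_on y {..<m}"
    and e: "\<And>i j. \<lbrakk>i < m; j < m\<rbrakk> \<Longrightarrow> (x i, y j) \<in> edges G \<longleftrightarrow> j = i \<or> i = Suc j mod m"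
  shows "induced_cycle G (2 * m) (\<lambda>k. if even k then x (k div 2) else y (k div 2))"
    (is "induced_cycle G _ ?c")
proof -
  have half: "k div 2 < m" if "k < 2 * m" for k using that by auto
  have disj: "colX G \<inter> colY G = {}" using G unfolding bipartite_graph_def by simp
  have "?c k \<in> verts G" if "k < 2 * m" for k
    using X[OF half[OF that]] Y[OF half[OF that]] by (simp add: verts_def)
  then have "?c ` {..<2 * m} \<subseteq> verts G" by blast
  moreover have "inj_on ?c {..<2 * m}"
  proof (rule inj_onI)
    fix i j assume "i \<in> {..<2 * m}" "j \<in> {..<2 * m}" and eq: "?c i = ?c j"
    then have ij: "i div 2 < m" "j div 2 < m" using half by blast+
    have "even i = even j"
      using eq X[OF ij(1)] Y[OF ij(1)] X[OF ij(2)] Y[OF ij(2)] disj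
      by (cases "even i"; cases "even j") auto
    moreover from this eq have "i div 2 = j div 2"
      using inj ij unfolding inj_on_def by (cases "even i") simp_all
    ultimately show "i = j" by presburger
  qed
  moreover have "adj G (?c i) (?c j) \<longleftrightarrow> j = Suc i mod (2 * m) \<or> i = Suc j mod (2 * m)"
    if ij: "i < 2 * m" "j < 2 * m" for i j
  proof -
    note h = half[OF ij(1)] half[OF ij(2)]
    \<comment> \<open>The modulus is even, so reduction keeps parity and consecutive indices have
      opposite parity, also at the wrap-around.\<close>
    have par: "even (Suc i mod (2 * m)) \<longleftrightarrow> odd i" for i
      by (simp add: dvd_mod_iff)
    have cyc: "2 * b + 1 = Suc (2 * a) mod (2 * m) \<or> 2 * a = Suc (2 * b + 1) mod (2 * m) \<longleftrightarrow>
        b = a \<or> a = Suc b mod m" if "a < m" "b < m" for a b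
    proof -
      have "Suc (2 * b + 1) mod (2 * m) = 2 * (Suc b mod m)"
          using mult_mod_right[of 2 "Suc b" m] by simp
      then show ?thesis using that by auto
    qed
    show ?thesis
    proof (cases "even i"; cases "even j")
      assume "even i" "even j"
      then show ?thesis
        using bipartite_adj(3)[OF G X[OF h(1)] X[OF h(2)]] par[of i] par[of j] by auto
    next
      assume "odd i" "odd j"
      then show ?thesis
        using bipartite_adj(4)[OF G Y[OF h(1)] Y[OF h(2)]] par[of i] par[of j] by auto
    next
      assume p: "even i" "odd j"
      then obtain a b where "i = 2 * a" "j = 2 * b + 1" by (metis evenE oddE)
      then show ?thesis
        using bipartite_adj(1)[OF G X Y, of a b] e[of a b] cyc[of a b] ij by simp
    next
      assume p: "odd i" "even j"
      then obtain a b where "j = 2 * a" "i = 2 * b + 1" by (metis evenE oddE)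
      then show ?thesis
        using bipartite_adj(2)[OF G X Y, of a b] e[of a b] cyc[of a b] ij
        by (simp add: disj_commute)
    qed
  qed
  ultimately show ?thesis unfolding induced_cycle_def by blast
qed

text \<open>The cycle is \<open>a\<close>, \<open>r\<close>, \<open>b\<close>, \<open>s\<close>,
  \<open>c\<close>, \<open>t\<close>. Applied to \<open>G\<close> and to \<open>mir G\<close>, this
  yields \<open>no_triangle\<close> and \<open>no_matching\<close>.\<close>

lemma no_hexagon:
  assumes G: "chordal_bipartite G"
    and X: "{a, b, c} \<subseteq> colX G" and Y: "{r, s, t} \<subseteq> colY G"
    and e: "(a, r) \<in> edges G" "(b, r) \<in> edges G" "(c, r) \<notin> edges G"
      "(a, s) \<notin> edges G" "(b, s) \<in> edges G" "(c, s) \<in> edges G"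
      "(a, t) \<in> edges G" "(b, t) \<notin> edges G" "(c, t) \<in> edges G"
  shows False
proof -
  have H: "bipartite_graph G" using G chordal_bipartite_def by blast
  \<comment> \<open>Distinctness comes for free, because the prescribed rows and columns of the
    adjacency pattern differ.\<close>
  have d: "distinct [a, b, c]" "distinct [r, s, t]" using e by auto
  have inj: "inj_on ((!) [a, b, c]) {..<3}" "inj_on ((!) [r, s, t]) {..<3}"
    using d by (auto intro!: inj_on_nth)
  have X': "[a, b, c] ! i \<in> colX G" and Y': "[r, s, t] ! i \<in> colY G" if "i < 3" for i
  proof -
    have "i \<in> {0, 1, 2}" using that by auto
    then show "[a, b, c] ! i \<in> colX G" "[r, s, t] ! i \<in> colY G" using X Y by auto
  qed
  have e': "([a, b, c] ! i, [r, s, t] ! j) \<in> edges G \<longleftrightarrow> j = i \<or> i = Suc j mod 3"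
    if "i < 3" "j < 3" for i j
  proof -
    have "i \<in> {0, 1, 2}" "j \<in> {0, 1, 2}" using that by auto
    then show ?thesis using e by (elim insertE emptyE) simp_all
  qed
  have "3 \<ge> (3 :: nat)" by simp
  then show False
    using induced_cycle_alternating[OF H X' Y' inj e'] G unfolding chordal_bipartite_def by blast
qed

lemma no_octagon:
  assumes G: "chordal_bipartite G"
    and X: "{a, b, c, d} \<subseteq> colX G" and Y: "{r, s, t, u} \<subseteq> colY G"
    and e: "(a, r) \<in> edges G" "(b, r) \<in> edges G" "(c, r) \<notin> edges G" "(d, r) \<notin> edges G"
      "(a, s) \<notin> edges G" "(b, s) \<in> edges G" "(c, s) \<in> edges G" "(d, s) \<notin> edges G"
      "(a, t) \<notin> edges G" "(b, t) \<notin> edges G" "(c, t) \<in> edges G" "(d, t) \<in> edges G"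
      "(a, u) \<in> edges G" "(b, u) \<notin> edges G" "(c, u) \<notin> edges G" "(d, u) \<in> edges G"
  shows False
proof -
  have H: "bipartite_graph G" using G chordal_bipartite_def by blast
  have d: "distinct [a, b, c, d]" "distinct [r, s, t, u]" using e by auto
  have inj: "inj_on ((!) [a, b, c, d]) {..<4}" "inj_on ((!) [r, s, t, u]) {..<4}"
    using d by (auto intro!: inj_on_nth)
  have X': "[a, b, c, d] ! i \<in> colX G" and Y': "[r, s, t, u] ! i \<in> colY G" if "i < 4" for i
  proof -
    have "i \<in> {0, 1, 2, 3}" using that by auto
    then show "[a, b, c, d] ! i \<in> colX G" "[r, s, t, u] ! i \<in> colY G" using X Y by auto
  qed
  have e': "([a, b, c, d] ! i, [r, s, t, u] ! j) \<in> edges G \<longleftrightarrow> j = i \<or> i = Suc j mod 4"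
    if "i < 4" "j < 4" for i j
  proof -
    have "i \<in> {0, 1, 2, 3}" "j \<in> {0, 1, 2, 3}" using that by auto
    then show ?thesis using e by (elim insertE emptyE) simp_all
  qed
  have "4 \<ge> (3 :: nat)" by simp
  then show False
    using induced_cycle_alternating[OF H X' Y' inj e'] G unfolding chordal_bipartite_def by blast
qed

text \<open>On a chordless cycle of length at least 6, three vertices of \<open>colY\<close> at
  consecutive even distances have pairwise incomparable neighborhoods.\<close>

lemma chordal_bipartiteI:
  assumes G: "bipartite_graph G"
    and two: "\<And>A. \<lbrakk>A \<subseteq> colY G; incomparable_nbhds G A\<rbrakk> \<Longrightarrow> card A \<le> 2"
  shows "chordal_bipartite G"
  unfolding chordal_bipartite_def
proof (intro conjI notI G)
  assume "\<exists>m c. m \<ge> 3 \<and> induced_cycle G (2 * m) c"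
  then obtain m c where m: "m \<ge> 3" and cyc: "induced_cycle G (2 * m) c" by blast
  define n where "n = 2 * m"
  have n: "n \<ge> 6" using m n_def by simp
  have V: "c i \<in> verts G" if "i < n" for i
    using cyc that unfolding induced_cycle_def n_def by blast
  have inj: "inj_on c {..<n}" using cyc unfolding induced_cycle_def n_def by blast
  have nb: "c j \<in> nbhd G (c i) \<longleftrightarrow>
      j = (if Suc i = n then 0 else Suc i) \<or> i = (if Suc j = n then 0 else Suc j)"
    if "i < n" "j < n" for i j
    using cyc that V unfolding induced_cycle_def nbhd_def n_def by (auto simp: mod_Suc)
  have step: "c i \<in> colX G \<longleftrightarrow> c (Suc i) \<in> colY G" if "Suc i < n" for i
  proof -
    have "adj G (c i) (c (Suc i))" using nb[of i "Suc i"] that unfolding nbhd_def by auto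
    then show ?thesis using G unfolding bipartite_graph_def adj_def by blast
  qed
  have step': "c i \<in> colY G \<longleftrightarrow> c (Suc i) \<in> colX G" if "Suc i < n" for i
  proof -
    have "adj G (c i) (c (Suc i))" using nb[of i "Suc i"] that unfolding nbhd_def by auto
    then show ?thesis using G unfolding bipartite_graph_def adj_def by blast
  qed
  \<comment> \<open>\<open>r\<close> tells whether the cycle starts in \<open>colY\<close> or one
    step before it.\<close>
  obtain r where r: "r \<in> {0, 1}" "c r \<in> colY G"
    using V[of 0] step[of 0] n unfolding verts_def by auto
  have "c (r + 2) \<in> colY G" using r n step[of "r + 1"] step'[of r] by auto
  moreover from this have "c (r + 4) \<in> colY G"
    using r(1) n step[of "r + 3"] step'[of "r + 2"] by (auto simp: eval_nat_numeral)
  ultimately have Y: "c ` {r, r + 2, r + 4} \<subseteq> colY G" using r by auto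
  have sep: "\<exists>k<n. c k \<in> nbhd G (c i) \<and> c k \<notin> nbhd G (c j)"
    \<comment> \<open>The witness is a cycle neighbor of \<open>c i\<close> that is not one of
      \<open>c j\<close>. For the pair \<open>r\<close>, \<open>r + 4\<close> it lies on the side of
      \<open>r + 2\<close>, because in a 6-cycle the two share their other neighbor. The case
      distinctions in the witnesses handle wrap-around.\<close>
    if ij: "i \<in> {r, r + 2, r + 4}" "j \<in> {r, r + 2, r + 4}" "i \<noteq> j" for i j
  proof -
    have w: ?thesis if "k < n" "i < n" "j < n"
       "k = (if Suc i = n then 0 else Suc i) \<or> i = (if Suc k = n then 0 else Suc k)"
       "k \<noteq> (if Suc j = n then 0 else Suc j) \<and> j \<noteq> (if Suc k = n then 0 else Suc k)" for k
      using nb[of i k] nb[of j k] that by blast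
    consider "i = r" "j = r + 2" | "i = r" "j = r + 4" | "i = r + 2" "j = r"
      | "i = r + 2" "j = r + 4" | "i = r + 4" "j = r" | "i = r + 4" "j = r + 2"
      using ij by blast
    then show ?thesis
    proof cases
      case 1 then show ?thesis using w[of "if r = 0 then n - 1 else 0"] r(1) n by auto
    next
      case 2 then show ?thesis using w[of "r + 1"] r(1) n by auto
    next
      case 3 then show ?thesis using w[of "r + 3"] r(1) n by auto
    next
      case 4 then show ?thesis using w[of "r + 1"] r(1) n by auto
    next
      case 5 then show ?thesis using w[of "r + 3"] r(1) n by auto
    next
      case 6 then show ?thesis using w[of "if r + 5 = n then 0 else r + 5"] r(1) n by auto
    qed
  qed
  have "incomparable_nbhds G (c ` {r, r + 2, r + 4})"
    unfolding incomparable_nbhds_def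
  proof (intro ballI impI)
    fix u v assume "u \<in> c ` {r, r + 2, r + 4}" "v \<in> c ` {r, r + 2, r + 4}" "u \<noteq> v"
    then obtain i j where ij: "i \<in> {r, r + 2, r + 4}" "j \<in> {r, r + 2, r + 4}"
      and uv: "u = c i" "v = c j" by (elim imageE)
    have "i \<noteq> j" using \<open>u \<noteq> v\<close> uv by blast
    then show "\<not> nbhd G u \<subseteq> nbhd G v \<and> \<not> nbhd G v \<subseteq> nbhd G u"
      using sep[OF ij] sep[OF ij(2,1)] uv by auto
  qed
  then have "card (c ` {r, r + 2, r + 4}) \<le> 2" using two Y by blast
  moreover have "card (c ` {r, r + 2, r + 4}) = card {r, r + 2, r + 4}"
    by (rule card_image, rule inj_on_subset[OF inj]) (use n r(1) in auto)
  ultimately show False by simp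
qed

section \<open>Antichains and copies of \<^term>\<open>B k\<close>\<close>

lemma ACB_separating_family:
  assumes "ACB G" and AX: "A \<subseteq> colX G" and inc: "incomparable_nbhds G A"
  shows "separating_family A ((\<lambda>y. {x. (x, y) \<in> edges G}) ` colY G)"
proof -
  have cb: "chordal_bipartite G" and cm: "chordal_bipartite (mir G)"
    using assms(1) ACB_def by blast+
  have G: "bipartite_graph G" using cb unfolding chordal_bipartite_def by simp
  have finX: "finite (colX G)" using G unfolding bipartite_graph_def by simp
  show ?thesis
  proof
    show "finite A" using AX finX by (rule finite_subset)
  next
    fix a b assume ab: "a \<in> A" "b \<in> A" "a \<noteq> b"
    then have "\<not> nbhd G a \<subseteq> nbhd G b" using inc unfolding incomparable_nbhds_def by simp
    moreover have "a \<in> colX G" "b \<in> colX G" using ab AX by blast+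
    ultimately show "\<exists>S\<in>(\<lambda>y. {x. (x, y) \<in> edges G}) ` colY G. a \<in> S \<and> b \<notin> S"
      using bipartite_nbhd(1)[OF G] by auto
  next
    fix a b c S T U
    assume "a \<in> A" "b \<in> A" "c \<in> A" "S \<in> (\<lambda>y. {x. (x, y) \<in> edges G}) ` colY G"
      "T \<in> (\<lambda>y. {x. (x, y) \<in> edges G}) ` colY G" "U \<in> (\<lambda>y. {x. (x, y) \<in> edges G}) ` colY G"
      "a \<notin> S" "b \<in> S" "c \<in> S" "a \<in> T" "b \<notin> T" "c \<in> T" "a \<in> U" "b \<in> U" "c \<notin> U"
    moreover from this obtain s t u where "s \<in> colY G" "S = {x. (x, s) \<in> edges G}"
      "t \<in> colY G" "T = {x. (x, t) \<in> edges G}" "u \<in> colY G" "U = {x. (x, u) \<in> edges G}"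
      by (elim imageE)
    \<comment> \<open>\<open>S\<close>, \<open>T\<close>, \<open>U\<close> miss \<open>a\<close>,
      \<open>b\<close>, \<open>c\<close> respectively, so the cycle is \<open>a\<close>,
      \<open>u\<close>, \<open>b\<close>, \<open>s\<close>, \<open>c\<close>,
      \<open>t\<close>.\<close>
    ultimately show False using no_hexagon[OF cb, of a b c u s t] AX by (simp add: subset_iff)
  next
    fix a b c S T U
    assume "a \<in> A" "b \<in> A" "c \<in> A" "S \<in> (\<lambda>y. {x. (x, y) \<in> edges G}) ` colY G"
      "T \<in> (\<lambda>y. {x. (x, y) \<in> edges G}) ` colY G" "U \<in> (\<lambda>y. {x. (x, y) \<in> edges G}) ` colY G"
      "a \<in> S" "b \<notin> S" "c \<notin> S" "a \<notin> T" "b \<in> T" "c \<notin> T" "a \<notin> U" "b \<notin> U" "c \<in> U"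
    moreover from this obtain s t u where "s \<in> colY G" "S = {x. (x, s) \<in> edges G}"
      "t \<in> colY G" "T = {x. (x, t) \<in> edges G}" "u \<in> colY G" "U = {x. (x, u) \<in> edges G}"
      by (elim imageE)
    ultimately show False using no_hexagon[OF cm, of a b c u s t] AX by (simp add: subset_iff)
  next
    fix a b c d S T U V
    assume "a \<in> A" "b \<in> A" "c \<in> A" "d \<in> A" "S \<in> (\<lambda>y. {x. (x, y) \<in> edges G}) ` colY G"
      "T \<in> (\<lambda>y. {x. (x, y) \<in> edges G}) ` colY G" "U \<in> (\<lambda>y. {x. (x, y) \<in> edges G}) ` colY G"
      "V \<in> (\<lambda>y. {x. (x, y) \<in> edges G}) ` colY G"
      "a \<in> S" "b \<in> S" "c \<notin> S" "d \<notin> S" "a \<notin> T" "b \<in> T" "c \<in> T" "d \<notin> T"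
      "a \<notin> U" "b \<notin> U" "c \<in> U" "d \<in> U" "a \<in> V" "b \<notin> V" "c \<notin> V" "d \<in> V"
    moreover from this obtain s t u v where "s \<in> colY G" "S = {x. (x, s) \<in> edges G}"
      "t \<in> colY G" "T = {x. (x, t) \<in> edges G}" "u \<in> colY G" "U = {x. (x, u) \<in> edges G}"
      "v \<in> colY G" "V = {x. (x, v) \<in> edges G}"
      by (elim imageE)
    ultimately show False using no_octagon[OF cb, of a b c d s t u v] AX by (simp add: subset_iff)
  qed
qed

text \<open>In \<open>B k\<close> the neighborhood of the j-th vertex of Y consists of the first j
  vertices of X if j < k, and of those from index j - k + 2 onwards otherwise. These are the
  segments that the linear arrangement provides. Injectivity of \<open>x\<close> and
  \<open>y\<close> is left to be read off the edge pattern.\<close>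

lemma ACB_contains_B:
  assumes "ACB G" "A \<subseteq> colX G" "incomparable_nbhds G A" "card A \<ge> 2"
  obtains x y :: "nat \<Rightarrow> 'a" where
    "\<And>i. i \<in> {1..card A} \<Longrightarrow> x i \<in> colX G" "\<And>j. j \<in> {1..2 * card A - 2} \<Longrightarrow> y j \<in> colY G"
    "\<And>i j. \<lbrakk>i \<in> {1..card A}; j \<in> {1..2 * card A - 2}\<rbrakk> \<Longrightarrow>
      (x i, y j) \<in> edges G \<longleftrightarrow> i \<le> j \<and> j \<le> i + card A - 2"
proof -
  define k where "k = card A"
  have k: "k \<ge> 2" using assms k_def by simp
  interpret separating_family A "(\<lambda>y. {x. (x, y) \<in> edges G}) ` colY G"
    using ACB_separating_family assms(1-3) .
  obtain pos where pos: "bij_betw pos A {1..k}"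
    and pre: "\<And>j. \<lbrakk>1 \<le> j; j < k\<rbrakk> \<Longrightarrow>
      \<exists>y\<in>colY G. \<forall>a\<in>A. (a, y) \<in> edges G \<longleftrightarrow> pos a \<le> j"
    and suf: "\<And>j. \<lbrakk>1 \<le> j; j < k\<rbrakk> \<Longrightarrow>
      \<exists>y\<in>colY G. \<forall>a\<in>A. (a, y) \<in> edges G \<longleftrightarrow> j < pos a"
    using ex_linear_arrangement[OF assms(4)] unfolding k_def by auto
  define x where "x = inv_into A pos"
  have x: "x i \<in> A" "pos (x i) = i" if "i \<in> {1..k}" for i
    using pos that unfolding x_def bij_betw_def by (metis inv_into_into, metis f_inv_into_f)
  have "\<exists>y\<in>colY G. \<forall>i\<in>{1..k}. (x i, y) \<in> edges G \<longleftrightarrow> i \<le> j \<and> j \<le> i + k - 2"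
    if j: "j \<in> {1..2 * k - 2}" for j
  proof (cases "j < k")
    case True
    then obtain y where "y \<in> colY G" "\<forall>a\<in>A. (a, y) \<in> edges G \<longleftrightarrow> pos a \<le> j"
      using pre[of j] j by auto
    moreover have "i \<le> j \<longleftrightarrow> i \<le> j \<and> j \<le> i + k - 2" if "i \<in> {1..k}" for i
      using that True by auto
    ultimately show ?thesis using x by metis
  next
    case False
    \<comment> \<open>Index \<open>k\<close> belongs to the largest proper final segment, with the
      cut after position 1.\<close>
    then have "1 \<le> j + 1 - k" "j + 1 - k < k" using j by auto
    then obtain y where "y \<in> colY G" "\<forall>a\<in>A. (a, y) \<in> edges G \<longleftrightarrow> j + 1 - k < pos a"
      using suf[of "j + 1 - k"] by blast
    moreover have "j + 1 - k < i \<longleftrightarrow> i \<le> j \<and> j \<le> i + k - 2" if "i \<in> {1..k}" for i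
      using that False k by auto
    ultimately show ?thesis using x by metis
  qed
  then obtain y where y: "\<And>j. j \<in> {1..2 * k - 2} \<Longrightarrow> y j \<in> colY G \<and>
      (\<forall>i\<in>{1..k}. (x i, y j) \<in> edges G \<longleftrightarrow> i \<le> j \<and> j \<le> i + k - 2)" by metis
  show thesis
    by (rule that[of x y]) (use x y assms(2) in \<open>auto simp flip: k_def\<close>)
qed

section \<open>Adjacency and separation of vertices in \<open>B k\<close>\<close>

lemma B_simps [simp]:
  "verts (B k) = Inl ` {1..k} \<union> Inr ` {1..2 * k - 2}"
  "\<not> adj (B k) (Inl i) (Inl i')" "\<not> adj (B k) (Inr j) (Inr j')"
  "adj (B k) (Inl i) (Inr j) \<longleftrightarrow> i \<in> {1..k} \<and> i \<le> j \<and> j \<le> i + k - 2"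
  "adj (B k) (Inr j) (Inl i) \<longleftrightarrow> i \<in> {1..k} \<and> i \<le> j \<and> j \<le> i + k - 2"
  by (auto simp: B_def verts_def adj_def)

text \<open>The intervals have equal length, so the left end of one avoids every later interval and
  its right end every earlier one.\<close>

lemma B_separates_X:
  fixes i i' k :: nat
  assumes "i \<in> {1..k}" "i' \<in> {1..k}" "i \<noteq> i'"
  shows "\<exists>j\<in>{1..2 * k - 2}. (i \<le> j \<and> j \<le> i + k - 2) \<and> \<not> (i' \<le> j \<and> j \<le> i' + k - 2)"
proof (cases "i < i'")
  case True
  then show ?thesis using assms by (intro bexI[of _ i]) auto
next
  case False
  then show ?thesis using assms by (intro bexI[of _ "i + k - 2"]) auto
qed

text \<open>Two initial segments differ at the end of the longer one, two final segments at the
  start of the longer one, and an initial differs from a final segment at 1.\<close>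

lemma B_separates_Y:
  fixes j j' k :: nat
  assumes j: "j \<in> {1..2 * k - 2}" "j' \<in> {1..2 * k - 2}" "j < j'"
  shows "\<exists>i\<in>{1..k}. (i \<le> j \<and> j \<le> i + k - 2) \<noteq> (i \<le> j' \<and> j' \<le> i + k - 2)"
proof -
  consider "j' < k" | "j < k" "k \<le> j'" | "k \<le> j" by linarith
  then show ?thesis
  proof cases
    case 1 then show ?thesis using j by (intro bexI[of _ j']) auto
  next
    case 2 then show ?thesis using j by (intro bexI[of _ 1]) auto
  next
    case 3 then show ?thesis using j by (intro bexI[of _ "j - k + 2"]) auto
  qed
qed

text \<open>The antichain yields an induced copy of \<open>B k\<close>. A vertex outside the copy
  could be deleted without destroying the copy's antichain of size \<open>k\<close>, so criticality
  leaves no such vertex.\<close>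

lemma critical_antichain_X:
  assumes crit: "critical_ACB k G" and "k \<ge> 2"
    and A: "A \<subseteq> colX G" "incomparable_nbhds G A" "card A = k"
  shows "isomorphic G (B k)"
proof -
  have "ACB G" using crit unfolding critical_ACB_def by simp
  then have G: "bipartite_graph G" unfolding ACB_def chordal_bipartite_def by simp
  then have fin: "finite (colX G)" "finite (colY G)" and disj: "colX G \<inter> colY G = {}"
    unfolding bipartite_graph_def by simp_all
  obtain x y where x: "\<And>i. i \<in> {1..k} \<Longrightarrow> x i \<in> colX G"
    and y: "\<And>j. j \<in> {1..2 * k - 2} \<Longrightarrow> y j \<in> colY G"
    and xy: "\<And>i j. \<lbrakk>i \<in> {1..k}; j \<in> {1..2 * k - 2}\<rbrakk> \<Longrightarrow>
      (x i, y j) \<in> edges G \<longleftrightarrow> i \<le> j \<and> j \<le> i + k - 2"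
    using ACB_contains_B[OF \<open>ACB G\<close> A(1,2)] A(3) \<open>k \<ge> 2\<close> by blast
  have injx: "inj_on x {1..k}"
  proof (rule inj_onI, rule ccontr)
    fix i i' assume i: "i \<in> {1..k}" "i' \<in> {1..k}" "x i = x i'" "i \<noteq> i'"
    obtain j where "j \<in> {1..2 * k - 2}" "i \<le> j \<and> j \<le> i + k - 2"
      "\<not> (i' \<le> j \<and> j \<le> i' + k - 2)" using B_separates_X[OF i(1,2,4)] by blast
    then show False using xy[of i j] xy[of i' j] i by simp
  qed
  have injy: "inj_on y {1..2 * k - 2}"
  proof (rule linorder_inj_onI)
    fix j j' assume j: "j < j'" "j \<in> {1..2 * k - 2}" "j' \<in> {1..2 * k - 2}"
    obtain i where "i \<in> {1..k}" "(i \<le> j \<and> j \<le> i + k - 2) \<noteq> (i \<le> j' \<and> j' \<le> i + k - 2)"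
      using B_separates_Y[OF j(2,3,1)] by blast
    then show "y j \<noteq> y j'" using xy[of i j] xy[of i j'] j by auto
  qed auto
  \<comment> \<open>The embedding of \<open>B k\<close> into \<open>G\<close>; its inverse is the
    required isomorphism.\<close>
  define g where "g = case_sum x y"
  have adjg: "adj G (g u) (g v) \<longleftrightarrow> adj (B k) u v" if "u \<in> verts (B k)" "v \<in> verts (B k)" for u v
    using that x y xy bipartite_adj[OF G] unfolding g_def by auto
  have ne: "x i \<noteq> y j" if "i \<in> {1..k}" "j \<in> {1..2 * k - 2}" for i j
    using x[OF that(1)] y[OF that(2)] disj by auto
  have inj: "inj_on g (verts (B k))"
  proof (rule inj_onI)
    fix u v assume "u \<in> verts (B k)" "v \<in> verts (B k)" and eq: "g u = g v"
    then have uv: "u \<in> Inl ` {1..k} \<union> Inr ` {1..2 * k - 2}"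
      "v \<in> Inl ` {1..k} \<union> Inr ` {1..2 * k - 2}" by simp_all
    then show "u = v"
      using eq ne inj_onD[OF injx] inj_onD[OF injy] unfolding g_def
      by (elim UnE imageE) (simp_all, metis+)
  qed
  have sub: "g ` verts (B k) \<subseteq> verts G"
    using x y unfolding g_def verts_def[of G] by auto
  have "v \<in> g ` verts (B k)" if v: "v \<in> verts G" for v
  proof (rule ccontr)
    assume nv: "v \<notin> g ` verts (B k)"
    then have nx: "x i \<noteq> v" if "i \<in> {1..k}" for i
      using that unfolding g_def by force
    have ny: "y j \<noteq> v" if "j \<in> {1..2 * k - 2}" for j
      using nv that unfolding g_def by force
    let ?H = "del_vertex G v"
    have "\<not> nbhd ?H (x i) \<subseteq> nbhd ?H (x i')" if i: "i \<in> {1..k}" "i' \<in> {1..k}" "i \<noteq> i'" for i i'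
    proof -
      obtain j where j: "j \<in> {1..2 * k - 2}" "(x i, y j) \<in> edges G" "(x i', y j) \<notin> edges G"
        using B_separates_X[OF i] xy i by blast
      then have "y j \<in> nbhd ?H (x i)" "y j \<notin> nbhd ?H (x i')"
        using i x y nx ny by (simp_all add: nbhd_del_vertex bipartite_nbhd[OF G])
      then show ?thesis by blast
    qed
    then have "incomparable_nbhds ?H (x ` {1..k})"
      unfolding incomparable_nbhds_def by (metis imageE)
    moreover have "x ` {1..k} \<subseteq> colX ?H" using x nx by (simp add: image_subset_iff)
    ultimately have "card (x ` {1..k}) \<le> bip_dilw ?H"
      using fin by (intro card_antichain_le_bip_dilw) auto
    then have "k \<le> bip_dilw ?H" using card_image[OF injx] by simp
    then show False using crit v \<open>k \<ge> 2\<close> unfolding critical_ACB_def by fastforce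
  qed
  then have bij: "bij_betw g (verts (B k)) (verts G)"
    using inj sub unfolding bij_betw_def by blast
  show ?thesis
    unfolding isomorphic_def
  proof (intro exI[of _ "inv_into (verts (B k)) g"] conjI ballI)
    show "bij_betw (inv_into (verts (B k)) g) (verts G) (verts (B k))"
      using bij by (rule bij_betw_inv_into)
    fix u v assume "u \<in> verts G" "v \<in> verts G"
    then show "adj G u v \<longleftrightarrow>
        adj (B k) (inv_into (verts (B k)) g u) (inv_into (verts (B k)) g v)"
      using adjg[of "inv_into (verts (B k)) g u" "inv_into (verts (B k)) g v"]
        bij_betw_inv_into_right[OF bij] bij_betwE[OF bij_betw_inv_into[OF bij]]
      by (simp del: B_simps)
  qed
qed

section \<open>Criticality of \<^term>\<open>B k\<close>\<close>

text \<open>An antichain meets each chain in at most one vertex.\<close>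

lemma card_antichain_two_chains:
  assumes "A \<subseteq> P \<union> Q" "incomparable_nbhds G A"
    and P: "\<And>u v. \<lbrakk>u \<in> P; v \<in> P\<rbrakk> \<Longrightarrow> nbhd G u \<subseteq> nbhd G v \<or> nbhd G v \<subseteq> nbhd G u"
    and Q: "\<And>u v. \<lbrakk>u \<in> Q; v \<in> Q\<rbrakk> \<Longrightarrow> nbhd G u \<subseteq> nbhd G v \<or> nbhd G v \<subseteq> nbhd G u"
  shows "card A \<le> 2"
proof (cases "finite A")
  case True
  have "u = v" if "u \<in> A" "v \<in> A" "u \<in> P \<and> v \<in> P \<or> u \<in> Q \<and> v \<in> Q" for u v
    using assms(2) P[of u v] Q[of u v] that unfolding incomparable_nbhds_def by metis
  then have "card (A \<inter> P) \<le> Suc 0" "card (A \<inter> Q) \<le> Suc 0"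
    using True by (simp_all add: card_le_Suc0_iff_eq)
  moreover have "A = (A \<inter> P) \<union> (A \<inter> Q)" using assms(1) by blast
  ultimately show ?thesis using card_Un_le[of "A \<inter> P" "A \<inter> Q"] by simp
qed simp

text \<open>The neighborhoods of \<open>colY\<close> form two chains, and so do their complements,
  which gives ACB. All of \<open>colX\<close> is an antichain, and deleting any vertex of
  \<open>G\<close> leaves no antichain of size \<open>k\<close>.\<close>

lemma critical_ACB_intervals:
  assumes k: "k \<ge> 2" and G: "bipartite_graph G"
    and p: "bij_betw p (colX G) {1..k}" and q: "bij_betw q (colY G) {1..2 * k - 2}"
    and e: "\<And>x y. \<lbrakk>x \<in> colX G; y \<in> colY G\<rbrakk> \<Longrightarrow>
      (x, y) \<in> edges G \<longleftrightarrow> p x \<le> q y \<and> q y \<le> p x + k - 2"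
  shows "critical_ACB k G"
proof -
  have fin: "finite (colX G)" "finite (colY G)" and disj: "colX G \<inter> colY G = {}"
    using G unfolding bipartite_graph_def by simp_all
  have cX: "card (colX G) = k" and cY: "card (colY G) = 2 * k - 2"
    using bij_betw_same_card[OF p] bij_betw_same_card[OF q] by simp_all
  have pr: "1 \<le> p x" "p x \<le> k" if "x \<in> colX G" for x using bij_betwE[OF p] that by auto
  have qr: "1 \<le> q y" "q y \<le> 2 * k - 2" if "y \<in> colY G" for y
    using bij_betwE[OF q] that by auto
  have nX: "nbhd G x = {y \<in> colY G. p x \<le> q y \<and> q y \<le> p x + k - 2}" if "x \<in> colX G" for x
    using e that by (auto simp: bipartite_nbhd[OF G])
  define P where "P = {y \<in> colY G. q y < k}"
  define Q where "Q = {y \<in> colY G. k \<le> q y}"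
  have PQ: "colY G = P \<union> Q" unfolding P_def Q_def by auto
  \<comment> \<open>One of the two interval bounds is automatic: the upper one on \<open>P\<close>,
    since \<open>p x\<close> is at least 1, and the lower one on \<open>Q\<close>, since
    \<open>p x\<close> is at most \<open>k\<close>.\<close>
  have nP: "nbhd G y = {x \<in> colX G. p x \<le> q y}" if "y \<in> P" for y
    using that e pr by (fastforce simp: bipartite_nbhd[OF G] P_def)
  have nQ: "nbhd G y = {x \<in> colX G. q y \<le> p x + k - 2}" if "y \<in> Q" for y
    using that e pr by (fastforce simp: bipartite_nbhd[OF G] Q_def)
  have chP: "nbhd G u \<subseteq> nbhd G v \<or> nbhd G v \<subseteq> nbhd G u" if "u \<in> P" "v \<in> P" for u v
    using nP[OF that(1)] nP[OF that(2)] by (cases "q u \<le> q v") auto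
  have chQ: "nbhd G u \<subseteq> nbhd G v \<or> nbhd G v \<subseteq> nbhd G u" if "u \<in> Q" "v \<in> Q" for u v
    using nQ[OF that(1)] nQ[OF that(2)] by (cases "q u \<le> q v") auto
  have nm: "nbhd (mir G) y = colX G - nbhd G y" if "y \<in> colY G" for y
    using that by (auto simp: bipartite_nbhd[OF G] bipartite_nbhd[OF bipartite_mir[OF G]])
  have two: "card A \<le> 2" if "A \<subseteq> colY G" "incomparable_nbhds G A" for A
    using card_antichain_two_chains[OF _ that(2) chP chQ] that(1) PQ by simp
  have two': "card A \<le> 2" if A: "A \<subseteq> colY (mir G)" "incomparable_nbhds (mir G) A" for A
  proof (rule card_antichain_two_chains[OF _ A(2)])
    show "A \<subseteq> P \<union> Q" using A(1) PQ by simp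
    show "nbhd (mir G) u \<subseteq> nbhd (mir G) v \<or> nbhd (mir G) v \<subseteq> nbhd (mir G) u"
      if "u \<in> P" "v \<in> P" for u v
      using chP[OF that] that PQ by (auto simp: nm)
    show "nbhd (mir G) u \<subseteq> nbhd (mir G) v \<or> nbhd (mir G) v \<subseteq> nbhd (mir G) u"
      if "u \<in> Q" "v \<in> Q" for u v
      using chQ[OF that] that PQ by (auto simp: nm)
  qed
  have ACB: "ACB G"
    unfolding ACB_def
    using chordal_bipartiteI[OF G two] chordal_bipartiteI[OF bipartite_mir[OF G] two'] by simp
  have "\<not> nbhd G x \<subseteq> nbhd G x'" if xx: "x \<in> colX G" "x' \<in> colX G" "x \<noteq> x'" for x x'
  proof -
    have "p x \<noteq> p x'" using p xx unfolding bij_betw_def inj_on_def by blast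
    moreover have "p x \<in> {1..k}" "p x' \<in> {1..k}" using pr xx by auto
    ultimately obtain j where "j \<in> {1..2 * k - 2}" "p x \<le> j \<and> j \<le> p x + k - 2"
      "\<not> (p x' \<le> j \<and> j \<le> p x' + k - 2)"
      using B_separates_X[of "p x" k "p x'"] by blast
    moreover from this obtain y where "y \<in> colY G" "q y = j"
      using q unfolding bij_betw_def by (metis imageE)
    ultimately show ?thesis using nX xx by blast
  qed
  then have "incomparable_nbhds G (colX G)" unfolding incomparable_nbhds_def by simp
  then have "k \<le> nabla G (colX G)" using nabla_ge[OF fin(1) order_refl] cX by metis
  moreover have "nabla G (colX G) \<le> k"
    using fin cX by (intro nabla_le) (auto intro: card_mono)
  moreover have "nabla G (colY G) \<le> k"
    using fin two k by (intro nabla_le) (auto intro: order_trans)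
  ultimately have dilw: "bip_dilw G = k" unfolding bip_dilw_def by simp
  have "bip_dilw (del_vertex G v) \<le> k - 1" if v: "v \<in> verts G" for v
  proof -
    let ?H = "del_vertex G v"
    have "nabla ?H (colX ?H) \<le> k - 1"
    proof (rule nabla_le)
      show "finite (colX ?H)" using fin by simp
      fix A assume A: "A \<subseteq> colX ?H" "incomparable_nbhds ?H A"
      \<comment> \<open>Only the whole of \<open>colX\<close> could reach size \<open>k\<close>, and
        it survives the deletion only if \<open>v\<close> lies in \<open>colY\<close>.\<close>
      have "A \<noteq> colX G"
      proof
        assume AX: "A = colX G"
        then have vX: "v \<notin> colX G" using A(1) by auto
        then have vY: "v \<in> colY G" using v unfolding verts_def by simp
        have neq: "q y \<noteq> q v" if "y \<in> colY G" "y \<noteq> v" for y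
          using q that vY unfolding bij_betw_def inj_on_def by blast
        have px: "\<exists>x\<in>colX G. p x = i" if "1 \<le> i" "i \<le> k" for i
          using p that unfolding bij_betw_def by (metis atLeastAtMost_iff imageE)
        have nH: "nbhd ?H x = {y \<in> colY G. y \<noteq> v \<and> p x \<le> q y \<and> q y \<le> p x + k - 2}"
          if "x \<in> colX G" for x
        proof -
          have "x \<noteq> v" using that vX by blast
          then show ?thesis using nX[OF that] by (auto simp: nbhd_del_vertex)
        qed
        \<comment> \<open>Neighborhoods of consecutive vertices of X differ by one vertex in each
          direction. If \<open>q v < k\<close>, then \<open>v\<close> is the left end of the
          interval at \<open>q v\<close>, which without it lies in the next interval. Otherwise
          \<open>v\<close> is the right end of the interval at \<open>q v + 2 - k\<close>, which
          without it lies in the previous one.\<close>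
        have "\<exists>x\<in>colX G. \<exists>x'\<in>colX G. x \<noteq> x' \<and> nbhd ?H x \<subseteq> nbhd ?H x'"
        proof (cases "q v < k")
          case True
          obtain x where x: "x \<in> colX G" "p x = q v" using px[of "q v"] qr[OF vY] True by auto
          obtain x' where x': "x' \<in> colX G" "p x' = Suc (q v)"
            using px[of "Suc (q v)"] True by auto
          have "x \<noteq> x'" using x x' by auto
          moreover have "nbhd ?H x \<subseteq> nbhd ?H x'"
          proof
            fix y assume "y \<in> nbhd ?H x"
            then have "y \<in> colY G" "y \<noteq> v" "q v \<le> q y" "q y \<le> q v + k - 2"
              using x nH[OF x(1)] by simp_all
            then show "y \<in> nbhd ?H x'"
              using x' nH[OF x'(1)] neq[of y] by simp
          qed
          ultimately show ?thesis using x x' by blast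
        next
          case False
          obtain x where x: "x \<in> colX G" "p x = q v + 2 - k"
            using px[of "q v + 2 - k"] qr[OF vY] False k by fastforce
          obtain x' where x': "x' \<in> colX G" "p x' = q v + 1 - k"
            using px[of "q v + 1 - k"] qr[OF vY] False by fastforce
          have "x \<noteq> x'" using x x' False by auto
          moreover have "nbhd ?H x \<subseteq> nbhd ?H x'"
          proof
            fix y assume "y \<in> nbhd ?H x"
            then have y: "y \<in> colY G" "y \<noteq> v" "q v + 2 - k \<le> q y" "q y \<le> q v + 2 - k + k - 2"
              using x nH[OF x(1)] by simp_all
            then have "q v + 1 - k \<le> q y" "q y \<le> q v + 1 - k + k - 2"
              using neq[of y] False by auto
            then show "y \<in> nbhd ?H x'"
              using x' nH[OF x'(1)] y by simp
          qed
          ultimately show ?thesis using x x' by blast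
        qed
        then show False using A(2) AX unfolding incomparable_nbhds_def by blast
      qed
      then have "A \<subset> colX G" using A(1) by auto
      then have "card A < k" using psubset_card_mono fin cX by metis
      then show "card A \<le> k - 1" by simp
    qed
    moreover have "nabla ?H (colY ?H) \<le> k - 1"
    proof (rule nabla_le)
      show "finite (colY ?H)" using fin by simp
      fix A assume A: "A \<subseteq> colY ?H" "incomparable_nbhds ?H A"
      \<comment> \<open>Removing \<open>v\<close> from two neighborhoods preserves inclusion, so
        incomparability after deletion implies it before.\<close>
      then have "incomparable_nbhds G A"
        unfolding incomparable_nbhds_def
        by (auto simp: nbhd_del_vertex subset_iff) (metis nbhd_del_vertex)+
      then have A2: "card A \<le> 2" using two A(1) by auto
      show "card A \<le> k - 1"
      \<comment> \<open>The bound 2 suffices except for \<open>k = 2\<close>. There, either one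
        vertex of Y remains, or all neighborhoods lie inside one singleton and are
        comparable.\<close>
      proof (cases "k = 2")
        case False
        then show ?thesis using A2 k by simp
      next
        case True
        show ?thesis
        proof (cases "v \<in> colY G")
          case vY: True
          then have "card (colY ?H) = 1" using cY True fin by simp
          then show ?thesis using card_mono[of "colY ?H" A] A(1) fin True by simp
        next
          case False
          then have vX: "v \<in> colX G" using v unfolding verts_def by simp
          then have "card (colX G - {v}) = 1" using cX True fin by simp
          then obtain z where z: "colX G - {v} = {z}" by (meson card_1_singletonE)
          have "nbhd ?H y \<subseteq> {z}" if "y \<in> A" for y
          proof -
            have "y \<in> colY G" "y \<noteq> v" using A(1) that by auto
            then have "nbhd ?H y \<subseteq> colX G - {v}"
              by (auto simp: nbhd_del_vertex bipartite_nbhd[OF G])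
            then show ?thesis using z by simp
          qed
          then have "u = w" if "u \<in> A" "w \<in> A" for u w
            using A(2) that unfolding incomparable_nbhds_def
            by (metis subset_singletonD order_refl empty_subsetI)
          moreover have "finite A" using A(1) fin finite_subset by fastforce
          ultimately show ?thesis using True card_le_Suc0_iff_eq[of A] by simp
        qed
      qed
    qed
    ultimately show ?thesis unfolding bip_dilw_def by simp
  qed
  then show ?thesis unfolding critical_ACB_def using ACB dilw by simp
qed

text \<open>Only the side of \<open>x\<close> is prescribed: every \<open>y j\<close> has a neighbor
  among the \<open>x i\<close>, which places it in the opposite class.\<close>

lemma critical_ACB_copy:
  assumes k: "k \<ge> 2" and G: "bipartite_graph G"
    and V: "verts G = x ` {1..k} \<union> y ` {1..2 * k - 2}"
    and inj: "inj_on x {1..k}" "inj_on y {1..2 * k - 2}"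
    and adj: "\<And>i j. \<lbrakk>i \<in> {1..k}; j \<in> {1..2 * k - 2}\<rbrakk> \<Longrightarrow>
      adj G (x i) (y j) \<longleftrightarrow> i \<le> j \<and> j \<le> i + k - 2"
    and X: "x ` {1..k} \<subseteq> colX G"
  shows "critical_ACB k G"
proof -
  have disj: "colX G \<inter> colY G = {}" and E: "edges G \<subseteq> colX G \<times> colY G"
    using G unfolding bipartite_graph_def by simp_all
  have "y j \<in> colY G" if j: "j \<in> {1..2 * k - 2}" for j
  proof -
    have "\<exists>i\<in>{1..k}. i \<le> j \<and> j \<le> i + k - 2"
    proof (cases "j \<le> k")
      case True then show ?thesis using j k by (intro bexI[of _ j]) auto
    next
      case False then show ?thesis using j k by (intro bexI[of _ k]) auto
    qed
    then obtain i where "i \<in> {1..k}" "adj G (x i) (y j)" using adj j by blast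
    then show ?thesis using X disj E unfolding adj_def by blast
  qed
  then have cX: "colX G = x ` {1..k}" and cY: "colY G = y ` {1..2 * k - 2}"
    using V X disj unfolding verts_def by blast+
  have x: "bij_betw x {1..k} (colX G)" and y: "bij_betw y {1..2 * k - 2} (colY G)"
    using inj cX cY unfolding bij_betw_def by simp_all
  show ?thesis
  proof (rule critical_ACB_intervals[OF k G bij_betw_inv_into[OF x] bij_betw_inv_into[OF y]])
    fix u w assume u: "u \<in> colX G" and w: "w \<in> colY G"
    obtain i j where ij: "i \<in> {1..k}" "u = x i" "j \<in> {1..2 * k - 2}" "w = y j"
      using u w cX cY by blast
    have "inv_into {1..k} x u = i" "inv_into {1..2 * k - 2} y w = j"
      using inj ij by simp_all
    then show "(u, w) \<in> edges G \<longleftrightarrow> inv_into {1..k} x u \<le> inv_into {1..2 * k - 2} y w \<and>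
        inv_into {1..2 * k - 2} y w \<le> inv_into {1..k} x u + k - 2"
      using adj[OF ij(1,3)] bipartite_adj(1)[OF G u w] ij by simp
  qed
qed

text \<open>An isomorphism ignores the color classes, so it must first be shown compatible with
  them, up to exchange. For k at least 3 this follows from connectedness; for k = 2 the numbering
  may have to be changed.\<close>

lemma critical_ACB_if_isomorphic:
  assumes k: "k \<ge> 2" and G: "bipartite_graph G" and "isomorphic G (B k)"
  shows "critical_ACB k G"
proof -
  obtain f where f: "bij_betw f (verts G) (verts (B k))"
    and adjf: "\<And>u v. \<lbrakk>u \<in> verts G; v \<in> verts G\<rbrakk> \<Longrightarrow> adj G u v \<longleftrightarrow> adj (B k) (f u) (f v)"
    using assms(3) unfolding isomorphic_def by blast
  define g where "g = inv_into (verts G) f"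
  have g: "bij_betw g (verts (B k)) (verts G)"
    unfolding g_def using f by (rule bij_betw_inv_into)
  have adjg: "adj G (g u) (g v) \<longleftrightarrow> adj (B k) u v"
    if "u \<in> verts (B k)" "v \<in> verts (B k)" for u v
    using adjf[of "g u" "g v"] that bij_betwE[OF g] bij_betw_inv_into_right[OF f]
    unfolding g_def by metis
  define x where "x = (\<lambda>i. g (Inl i))"
  define y where "y = (\<lambda>j. g (Inr j))"
  have V: "verts G = x ` {1..k} \<union> y ` {1..2 * k - 2}"
    using bij_betw_imp_surj_on[OF g] unfolding x_def y_def by (simp add: image_Un image_image)
  have injg: "inj_on g (verts (B k))" using g unfolding bij_betw_def by simp
  have inj: "inj_on x {1..k}" "inj_on y {1..2 * k - 2}"
    using inj_on_subset[OF injg] comp_inj_on[of Inl _ g] comp_inj_on[of Inr _ g]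
    unfolding x_def y_def by (simp_all add: comp_def)
  have ne: "x i \<noteq> y j" if "i \<in> {1..k}" "j \<in> {1..2 * k - 2}" for i j
    using inj_onD[OF injg, of "Inl i" "Inr j"] that unfolding x_def y_def by auto
  have adj: "adj G (x i) (y j) \<longleftrightarrow> i \<le> j \<and> j \<le> i + k - 2"
    if "i \<in> {1..k}" "j \<in> {1..2 * k - 2}" for i j
    using adjg[of "Inl i" "Inr j"] that unfolding x_def y_def by simp
  have disj: "colX G \<inter> colY G = {}" and E: "edges G \<subseteq> colX G \<times> colY G"
    using G unfolding bipartite_graph_def by simp_all
  have swap: "critical_ACB k G" if "x ` {1..k} \<subseteq> colX G \<or> x ` {1..k} \<subseteq> colY G"
    using that critical_ACB_copy[OF k G V inj adj]
      critical_ACB_copy[of k "swap_classes G" x y] k G V inj adj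
    by (simp add: critical_ACB_swap_classes) blast
  show ?thesis
  proof (cases "k = 2")
    case False
    then have k3: "k \<ge> 3" using k by simp
    have all: "x i \<in> C" if C: "C = colX G \<or> C = colY G" "x 1 \<in> C" and i: "1 \<le> i" "i \<le> k"
      for i C
      using i
    proof (induction i rule: dec_induct)
      case base
      then show ?case using C by simp
    next
      case (step i)
      \<comment> \<open>Consecutive \<open>x i\<close> share this neighbor, as their intervals have
        at least two elements when k is at least 3; hence they lie in the same class.\<close>
      have "adj G (x i) (y (Suc i))" "adj G (x (Suc i)) (y (Suc i))"
        using adj[of i "Suc i"] adj[of "Suc i" "Suc i"] step k3 by auto
      then show ?case using step C disj E unfolding adj_def by auto
    qed
    have "x 1 \<in> colX G \<or> x 1 \<in> colY G" using V k unfolding verts_def by auto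
    then have "x ` {1..k} \<subseteq> colX G \<or> x ` {1..k} \<subseteq> colY G"
      using all[of "colX G"] all[of "colY G"] by auto
    then show ?thesis by (rule swap)
  next
    case True
    have two: "{1..k} = {1, 2}" "{1..2 * k - 2} = {1, 2}" using True by auto
    have e: "adj G (x 1) (y 1)" "adj G (x 2) (y 2)" "\<not> adj G (x 1) (y 2)" "\<not> adj G (x 2) (y 1)"
      using adj two True by simp_all
    have nadj: "\<not> adj G (x 1) (x 2)" "\<not> adj G (y 1) (y 2)"
      using adjg[of "Inl 1" "Inl 2"] adjg[of "Inr 1" "Inr 2"] True
      unfolding x_def y_def by auto
    text \<open>Here \<^term>\<open>B 2\<close> is disconnected, so the two edges may be oriented independently.\<close>
    define x' where "x' = (\<lambda>i::nat. if i = 1 then x 1 else y 2)"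
    define y' where "y' = (\<lambda>i::nat. if i = 1 then y 1 else x 2)"
    have V': "verts G = x' ` {1..k} \<union> y' ` {1..2 * k - 2}"
      unfolding V two x'_def y'_def by auto
    have inj': "inj_on x' {1..k}" "inj_on y' {1..2 * k - 2}"
      using ne[of 1 2] ne[of 2 1] unfolding two x'_def y'_def inj_on_def by auto
    have adj': "adj G (x' i) (y' j) \<longleftrightarrow> i \<le> j \<and> j \<le> i + k - 2"
      if "i \<in> {1..k}" "j \<in> {1..2 * k - 2}" for i j
      using that e nadj adj_commute[of G] True unfolding two x'_def y'_def by auto
    have swap': "critical_ACB k G" if "x' ` {1..k} \<subseteq> colX G \<or> x' ` {1..k} \<subseteq> colY G"
      using that critical_ACB_copy[OF k G V' inj' adj']
        critical_ACB_copy[of k "swap_classes G" x' y'] k G V' inj' adj'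
      by (simp add: critical_ACB_swap_classes) blast
    have "x 1 \<in> colX G \<union> colY G" "x 2 \<in> colX G \<union> colY G"
      using V unfolding two verts_def by auto
    \<comment> \<open>If \<open>x 1\<close> and \<open>x 2\<close> lie in different classes, then
      \<open>y 2\<close> lies with \<open>x 1\<close> and the re-oriented numbering applies.\<close>
    moreover have "x 2 \<in> colX G \<Longrightarrow> y 2 \<in> colY G" "x 2 \<in> colY G \<Longrightarrow> y 2 \<in> colX G"
      using e(2) disj E unfolding adj_def by blast+
    ultimately show ?thesis using swap swap' unfolding two x'_def by auto
  qed
qed

theorem theorem4:
  fixes k :: nat and G :: "'a bigraph"
  assumes "k \<ge> 2" and "bipartite_graph G"
  shows "critical_ACB k G \<longleftrightarrow> isomorphic G (B k)"
proof
  assume crit: "critical_ACB k G"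
  have fin: "finite (colX G)" "finite (colY G)"
    using assms(2) unfolding bipartite_graph_def by simp_all
  have "bip_dilw G = k" using crit unfolding critical_ACB_def by simp
  then consider "nabla G (colX G) = k" | "nabla G (colY G) = k"
    unfolding bip_dilw_def by linarith
  then show "isomorphic G (B k)"
  proof cases
    case 1
    then show ?thesis
      using nabla_attained[OF fin(1), of G] critical_antichain_X[OF crit assms(1)] by metis
  next
    case 2
    then obtain A where "A \<subseteq> colY G" "incomparable_nbhds G A" "card A = k"
      using nabla_attained[OF fin(2), of G] by metis
    \<comment> \<open>Exchanging the classes moves the antichain into \<open>colX\<close> and leaves
      adjacency, hence isomorphism, unchanged.\<close>
    then have "isomorphic (swap_classes G) (B k)"
      using crit assms(1)
      by (intro critical_antichain_X)
        (simp_all add: critical_ACB_swap_classes incomparable_nbhds_def)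
    then show ?thesis unfolding isomorphic_def by simp
  qed
next
  assume "isomorphic G (B k)"
  with assms show "critical_ACB k G" by (rule critical_ACB_if_isomorphic)
qed

end
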